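(* Let $\lambda$ and $\mu$ be partitions of lengths $r_1$ and $r_2$, let $r=r_1+r_2$, and let $\alpha\in\mathbb{R}$. Then $$\lim_{n\to\infty}\frac{(-1)^r}{n^{\alpha+r}}L^{(\alpha)}_{\lambda,\mu,n}\left(\frac{x}{4n}\right)=\Omega^{(\alpha)}_{\lambda,\mu}(0)\,2^{\alpha+r}\,x^{-\frac{\alpha+r}{2}}J_{\alpha+r}(\sqrt{x}),$$ uniformly for $x$ in compact subsets of the complex plane, where $n$ tends to infinity through $\mathbb{N}_{\lambda,\mu}$, $J_\nu$ is the Bessel function of the first kind of order $\nu$, and $x^{-\nu/2}J_\nu(\sqrt x)$ is understood as an entire function of $x$.
   Context: For $\alpha\in\mathbb{R}$ and an integer $n\ge 0$, $L^{(\alpha)}_n(x)=\frac{e^x x^{-\alpha}}{n!}\frac{d^n}{dx^n}\left(e^{-x}x^{n+\alpha}\right)$ is the Laguerre polynomial of degree $n$ (so $L_n^{(\alpha)}(x)=\sum_{k=0}^n\binom{n+\alpha}{n-k}\frac{(-x)^k}{k!}$). For sufficiently differentiable functions, $\mathrm{Wr}[f_1,\dots,f_r]=\det\left(\frac{d^{j-1}}{dx^{j-1}}f_i\right)_{1\le i,j\le r}$ is the Wronskian (the empty Wronskian is $1$). A partition $\lambda=(\lambda_1,\dots,\lambda_{r_1})$ is a weakly decreasing (possibly empty) finite sequence of positive integers, $r_1$ is its length and $|\lambda|=\sum_j\lambda_j$. To partitions $\lambda$ of length $r_1$ and $\mu$ of length $r_2$ associate $n_j=\lambda_j+r_1-j$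 ($1\le j\le r_1$), $m_j=\mu_j+r_2-j$ ($1\le j\le r_2$), $r=r_1+r_2$, and the functions $f_j(x)=L^{(\alpha)}_{n_j}(x)$ for $j=1,\dots,r_1$ and $f_{r_1+j}(x)=e^xL^{(\alpha)}_{m_j}(-x)$ for $j=1,\dots,r_2$. The generalized Laguerre polynomial is $\Omega^{(\alpha)}_{\lambda,\mu}(x)=e^{-r_2x}\,\mathrm{Wr}[f_1,\dots,f_r](x)$; it is a polynomial. The degree sequence is $$\mathbb{N}_{\lambda,\mu}=\{n\in\{0,1,2,\dots\} : n\ge|\lambda|+|\mu|-r_1 \text{ and } n-|\lambda|-|\mu|\ne\lambda_j-j \text{ for } j=1,\dots,r_1\}.$$ For $n\in\mathbb{N}_{\lambda,\mu}$ the exceptional Laguerre polynomial is $$L^{(\alpha)}_{\lambda,\mu,n}(x)=e^{-r_2x}\,\mathrm{Wr}\left[f_1,\dots,f_r,L^{(\alpha)}_s\right](x),\qquad s=n-|\lambda|-|\mu|+r_1,$$ which is a polynomial of degree $n$. *)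

theory Defs
  imports "HOL-Complex_Analysis.Complex_Analysis" "Jordan_Normal_Form.Determinant"
begin

text \<open>The explicit sum defines the polynomial at every complex argument; Rodrigues' formula, valid
  off the branch cut, is \<open>laguerre_Rodrigues\<close>.\<close>

definition laguerre :: "real \<Rightarrow> nat \<Rightarrow> complex \<Rightarrow> complex" where
  "laguerre \<alpha> n x =
     (\<Sum>k\<le>n. of_real ((real n + \<alpha>) gchoose (n - k)) * (- x) ^ k / fact k)"

lemma higher_deriv_exp_minus: "(deriv ^^ n) (\<lambda>w::complex. exp (- w)) = (\<lambda>w. (-1) ^ n * exp (- w))"
proof (induction n)
  case (Suc n)
  have "((\<lambda>w::complex. (-1) ^ n * exp (- w)) has_field_derivative (-1) ^ Suc n * exp (- w)) (at w)" for w
    by (auto intro!: derivative_eq_intros)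
  then show ?case
    using Suc by (auto intro!: ext DERIV_imp_deriv)
qed auto

lemma higher_deriv_powr:
  fixes b z :: complex
  assumes "z \<notin> \<real>\<^sub>\<le>\<^sub>0"
  shows "(deriv ^^ n) (\<lambda>w. w powr b) z = fact n * (b gchoose n) * z powr (b - of_nat n)"
  using assms
proof (induction n arbitrary: z)
  case (Suc n)
  let ?S = "- \<real>\<^sub>\<le>\<^sub>0 :: complex set"
  have op: "open ?S"
    by (simp add: open_Compl closed_nonpos_Reals_complex)
  have "(deriv ^^ Suc n) (\<lambda>w. w powr b) z = deriv ((deriv ^^ n) (\<lambda>w. w powr b)) z"
    by simp
  also have "\<dots> = deriv (\<lambda>w. fact n * (b gchoose n) * w powr (b - of_nat n)) z"
  proof (rule deriv_cong_ev)
    have "eventually (\<lambda>w. w \<in> ?S) (nhds z)"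
      using op Suc.prems by (intro eventually_nhds_in_open) auto
    then show "\<forall>\<^sub>F x in nhds z. (deriv ^^ n) (\<lambda>w. w powr b) x = fact n * (b gchoose n) * x powr (b - of_nat n)"
      by eventually_elim (use Suc.IH in auto)
  qed auto
  also have "\<dots> = fact n * (b gchoose n) * ((b - of_nat n) * z powr (b - of_nat n - 1))"
    by (rule DERIV_imp_deriv) (use Suc.prems in \<open>auto intro!: derivative_eq_intros\<close>)
  also have "\<dots> = fact (Suc n) * (b gchoose Suc n) * z powr (b - of_nat (Suc n))"
  proof -
    have "fact n * (b gchoose n) * (b - of_nat n) = fact (Suc n) * (b gchoose Suc n)"
      using of_nat_neq_0[of n, where 'a = complex]
      by (simp add: gbinomial_prod_rev prod.atLeast0_lessThan_Suc del: of_nat_Suc)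
    then show ?thesis
      by (simp add: diff_diff_eq add.commute flip: mult.assoc)
  qed
  finally show ?case .
qed auto

lemma laguerre_Rodrigues:
  assumes z: "z \<notin> \<real>\<^sub>\<le>\<^sub>0"
  shows "laguerre \<alpha> n z = exp z * z powr (- of_real \<alpha>) / fact n *
    (deriv ^^ n) (\<lambda>w. exp (- w) * w powr (of_nat n + of_real \<alpha>)) z"
proof -
  let ?S = "- \<real>\<^sub>\<le>\<^sub>0 :: complex set"
  let ?b = "of_nat n + of_real \<alpha> :: complex"
  have z0: "z \<noteq> 0" using z by auto
  have op: "open ?S"
    by (simp add: open_Compl closed_nonpos_Reals_complex)
  have "(deriv ^^ n) (\<lambda>w. exp (- w) * w powr ?b) z =
     (\<Sum>i = 0..n. of_nat (n choose i) * (deriv ^^ i) (\<lambda>w. exp (- w)) z *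
        (deriv ^^ (n - i)) (\<lambda>w. w powr ?b) z)"
    by (rule higher_deriv_mult[OF _ _ op]) (use z in \<open>auto intro!: holomorphic_intros\<close>)
  also have "\<dots> = (\<Sum>i\<le>n. of_nat (n choose i) * ((-1) ^ i * exp (- z)) *
        (fact (n - i) * (?b gchoose (n - i)) * z powr (of_real \<alpha> + of_nat i)))"
    unfolding higher_deriv_exp_minus atMost_atLeast0
    by (intro sum.cong refl) (simp add: higher_deriv_powr[OF z] of_nat_diff)
  finally have eq: "(deriv ^^ n) (\<lambda>w. exp (- w) * w powr ?b) z = \<dots>" .
  have term_eq: "exp z * z powr (- of_real \<alpha>) / fact n *
        (of_nat (n choose i) * ((-1) ^ i * exp (- z)) *
        (fact (n - i) * (?b gchoose (n - i)) * z powr (of_real \<alpha> + of_nat i)))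
      = of_real ((real n + \<alpha>) gchoose (n - i)) * (- z) ^ i / fact i" if "i \<le> n" for i
  proof -
    have p: "z powr (- of_real \<alpha>) * z powr (of_real \<alpha> + of_nat i) = z ^ i"
      using z0 by (simp add: powr_nat flip: powr_add)
    have e: "exp z * exp (- z) = 1"
      by (simp flip: exp_add)
    have c: "of_nat (n choose i) * fact (n - i) / fact n = (1 / fact i :: complex)"
      using that by (simp add: binomial_fact)
    have g: "?b gchoose (n - i) = of_real ((real n + \<alpha>) gchoose (n - i))"
      by (simp add: gbinomial_prod_rev)
    have "exp z * z powr (- of_real \<alpha>) / fact n *
        (of_nat (n choose i) * ((-1) ^ i * exp (- z)) *
        (fact (n - i) * (?b gchoose (n - i)) * z powr (of_real \<alpha> + of_nat i)))
      = (exp z * exp (- z)) * (z powr (- of_real \<alpha>) * z powr (of_real \<alpha> + of_nat i)) *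
        (of_nat (n choose i) * fact (n - i) / fact n) * (-1) ^ i * (?b gchoose (n - i))"
      by (simp add: field_simps)
    also have "\<dots> = of_real ((real n + \<alpha>) gchoose (n - i)) * (- z) ^ i / fact i"
      unfolding p e c g by (simp add: power_minus[of z])
    finally show ?thesis .
  qed
  show ?thesis
    unfolding eq laguerre_def sum_distrib_left
    by (intro sum.cong refl) (use term_eq in auto)
qed

definition wronskian :: "(complex \<Rightarrow> complex) list \<Rightarrow> complex \<Rightarrow> complex" where
  "wronskian fs x =
     Determinant.det (Matrix.mat (length fs) (length fs) (\<lambda>(i, j). (deriv ^^ j) (fs ! i) x))"

lemma wronskian_Nil: "wronskian [] x = 1"
  by (simp add: wronskian_def)

definition is_partition :: "nat list \<Rightarrow> bool" where
  "is_partition lam \<longleftrightarrow> sorted_wrt (\<ge>) lam \<and> (\<forall>k\<in>set lam. 0 < k)"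

text \<open>Parts are indexed from 1, so that the \<open>j\<close>-th part of \<open>lam\<close> is \<open>lam ! (j - 1)\<close>.\<close>

definition shifted_parts :: "nat list \<Rightarrow> nat list" where
  "shifted_parts lam = map (\<lambda>j. lam ! (j - 1) + length lam - j) [1..<length lam + 1]"

definition seed_functions :: "real \<Rightarrow> nat list \<Rightarrow> nat list \<Rightarrow> (complex \<Rightarrow> complex) list" where
  "seed_functions \<alpha> lam mu =
     map (\<lambda>n. laguerre \<alpha> n) (shifted_parts lam) @
     map (\<lambda>m x. exp x * laguerre \<alpha> m (- x)) (shifted_parts mu)"

definition generalized_laguerre :: "real \<Rightarrow> nat list \<Rightarrow> nat list \<Rightarrow> complex \<Rightarrow> complex" where
  "generalized_laguerre \<alpha> lam mu x =
     exp (- of_nat (length mu) * x) * wronskian (seed_functions \<alpha> lam mu) x"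

definition degree_sequence :: "nat list \<Rightarrow> nat list \<Rightarrow> nat set" where
  "degree_sequence lam mu =
     {n. int n \<ge> int (sum_list lam) + int (sum_list mu) - int (length lam) \<and>
         (\<forall>j\<in>{1..length lam}.
            int n - int (sum_list lam) - int (sum_list mu) \<noteq> int (lam ! (j - 1)) - int j)}"

text \<open>For \<open>n\<close> in the degree sequence the natural-number subtraction below does not truncate.\<close>

definition exceptional_laguerre ::
    "real \<Rightarrow> nat list \<Rightarrow> nat list \<Rightarrow> nat \<Rightarrow> complex \<Rightarrow> complex" where
  "exceptional_laguerre \<alpha> lam mu n x =
     exp (- of_nat (length mu) * x) *
     wronskian (seed_functions \<alpha> lam mu @
       [laguerre \<alpha> (n + length lam - sum_list lam - sum_list mu)]) x"

text \<open>The principal branch of the Bessel function of the first kind. The value at \<open>0\<close> is treated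
  separately because \<open>0 powr 0 = 0\<close>; it is only meaningful for \<open>\<nu> \<ge> 0\<close> or integer \<open>\<nu>\<close>.\<close>

definition bessel_J :: "real \<Rightarrow> complex \<Rightarrow> complex" where
  "bessel_J \<nu> z =
     (if z = 0 then (if \<nu> = 0 then 1 else 0)
      else (z / 2) powr of_real \<nu> *
        (\<Sum>k. (-1) ^ k * rGamma (of_real \<nu> + of_nat k + 1) / fact k * (z / 2) ^ (2 * k)))"

text \<open>The entire function of \<open>x\<close> that extends the product of \<open>x powr (- \<nu> / 2)\<close> and the Bessel
  function of order \<open>\<nu>\<close> at the square root of \<open>x\<close>. Its existence and uniqueness are shown in
  \<open>bessel_entire_characterization\<close>.\<close>

definition bessel_entire :: "real \<Rightarrow> complex \<Rightarrow> complex" where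
  "bessel_entire \<nu> = (THE g. g holomorphic_on UNIV \<and>
     (\<forall>x. x \<noteq> 0 \<longrightarrow> g x = x powr (- of_real \<nu> / 2) * bessel_J \<nu> (csqrt x)))"

definition bessel_coeff :: "real \<Rightarrow> nat \<Rightarrow> complex" where
  "bessel_coeff \<nu> k = (-1) ^ k * rGamma (of_real \<nu> + of_nat k + 1) / (fact k * 4 ^ k)"

lemma summable_bessel: "summable (\<lambda>k. bessel_coeff \<nu> k * x ^ k)"
proof -
  obtain N where N: "real N > norm x + \<bar>\<nu>\<bar> + 1"
    using reals_Archimedean2 by blast
  show ?thesis
  proof (rule summable_ratio_test[of "1/4" N])
    fix k assume k: "k \<ge> N"
    let ?w = "of_real \<nu> + of_nat k + 1 :: complex"
    have w: "?w = of_real (\<nu> + real k + 1)" by simp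
    have nw: "norm ?w \<ge> norm x" "norm ?w \<ge> 1"
      unfolding w norm_of_real using N k norm_ge_zero[of x] by linarith+
    have "rGamma ?w = ?w * rGamma (?w + 1)"
      by (rule rGamma_plus1[symmetric])
    then have "bessel_coeff \<nu> k = - 4 * of_nat (Suc k) * ?w * bessel_coeff \<nu> (Suc k)"
      by (simp add: bessel_coeff_def field_simps del: of_nat_Suc) (simp add: algebra_simps)
    then have "norm (bessel_coeff \<nu> k) = 4 * real (Suc k) * norm ?w * norm (bessel_coeff \<nu> (Suc k))"
      by (simp add: norm_mult del: of_nat_Suc)
    moreover have "norm x \<le> real (Suc k) * norm ?w"
    proof -
      have "1 * norm x \<le> real (Suc k) * norm ?w"
        using nw by (intro mult_mono) auto
      then show ?thesis by simp
    qed
    ultimately have "norm x * norm (bessel_coeff \<nu> (Suc k)) \<le> 1/4 * norm (bessel_coeff \<nu> k)"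
      using mult_right_mono[of "norm x" "real (Suc k) * norm ?w" "norm (bessel_coeff \<nu> (Suc k))"]
      by (simp add: algebra_simps)
    then have "norm x * norm (bessel_coeff \<nu> (Suc k)) * norm x ^ k
        \<le> 1/4 * norm (bessel_coeff \<nu> k) * norm x ^ k"
      by (rule mult_right_mono) simp
    then show "norm (bessel_coeff \<nu> (Suc k) * x ^ Suc k) \<le> 1/4 * norm (bessel_coeff \<nu> k * x ^ k)"
      by (simp add: norm_mult norm_power mult_ac)
  qed simp
qed

lemma bessel_entire_characterization:
  "bessel_entire \<nu> holomorphic_on UNIV" (is ?A)
  "x \<noteq> 0 \<Longrightarrow> bessel_entire \<nu> x = x powr (- of_real \<nu> / 2) * bessel_J \<nu> (csqrt x)" (is "_ \<Longrightarrow> ?B")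
  "bessel_entire \<nu> x = of_real (2 powr (- \<nu>)) * (\<Sum>k. bessel_coeff \<nu> k * x ^ k)" (is ?C)
proof -
  define P where "P = (\<lambda>g. g holomorphic_on UNIV \<and>
     (\<forall>x. x \<noteq> 0 \<longrightarrow> g x = x powr (- of_real \<nu> / 2) * bessel_J \<nu> (csqrt x)))"
  define h where "h = (\<lambda>x. of_real (2 powr (- \<nu>)) * (\<Sum>k. bessel_coeff \<nu> k * x ^ k))"
  have "(h has_field_derivative
      of_real (2 powr (- \<nu>)) * (\<Sum>k. diffs (bessel_coeff \<nu>) k * x ^ k)) (at x)" for x
    unfolding h_def
    by (intro DERIV_cmult termdiffs_strong_converges_everywhere summable_bessel)
  then have hol: "h holomorphic_on UNIV"
    by (meson DERIV_subset holomorphic_onI field_differentiable_def subset_UNIV)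
  have val: "h x = x powr (- of_real \<nu> / 2) * bessel_J \<nu> (csqrt x)" if x: "x \<noteq> 0" for x
  proof -
    have s0: "csqrt x \<noteq> 0" using x by simp
    have "Ln (csqrt x) = Ln x / 2"
      using x mpi_less_Im_Ln[of x] Im_Ln_le_pi[of x] by (simp add: csqrt_exp_Ln)
    then have Ln: "Ln (csqrt x / 2) = Ln x / 2 - of_real (ln 2)"
      using s0 x Ln_divide_of_real[of 2 "csqrt x"] by simp
    have "(csqrt x / 2) powr of_real \<nu> = exp (of_real \<nu> * (Ln x / 2 - of_real (ln 2)))"
      using s0 by (simp add: powr_def Ln)
    also have "\<dots> = exp (of_real \<nu> * Ln x / 2 + of_real (- \<nu> * ln 2))"
      by (simp add: right_diff_distrib)
    also have "\<dots> = exp (of_real \<nu> * Ln x / 2) * of_real (2 powr (- \<nu>))"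
      unfolding exp_add exp_of_real by (simp add: powr_def)
    finally have 1: "x powr (- of_real \<nu> / 2) * (csqrt x / 2) powr of_real \<nu> = of_real (2 powr (- \<nu>))"
      using x by (simp add: powr_def exp_minus field_simps flip: exp_add)
    have 2: "(-1) ^ k * rGamma (of_real \<nu> + of_nat k + 1) / fact k * (csqrt x / 2) ^ (2 * k)
      = bessel_coeff \<nu> k * x ^ k" for k
    proof -
      have "(csqrt x / 2) ^ (2 * k) = x ^ k / 4 ^ k"
        unfolding power_mult by (simp add: power_divide)
      then show ?thesis by (simp add: bessel_coeff_def)
    qed
    show ?thesis
      using s0 unfolding bessel_J_def h_def 2 by (simp add: 1[symmetric])
  qed
  have "P h" unfolding P_def using hol val by blast
  moreover have "g = h" if "P g" for g
  proof
    fix x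
    show "g x = h x"
    proof (cases "x = 0")
      case True
      have g: "g \<midarrow>0\<rightarrow> g 0" and h: "h \<midarrow>0\<rightarrow> h 0"
        using that hol unfolding P_def
        by (auto dest!: holomorphic_on_imp_continuous_on simp: continuous_on_eq_continuous_at isCont_def)
      have "\<forall>\<^sub>F x in at 0. g x = h x"
        using that val unfolding P_def by (auto simp: eventually_at_filter)
      then have "h \<midarrow>0\<rightarrow> g 0"
        using g tendsto_cong by blast
      then show ?thesis
        using h True tendsto_unique[OF at_neq_bot] by blast
    qed (use that val in \<open>auto simp: P_def\<close>)
  qed
  ultimately have "bessel_entire \<nu> = h"
    unfolding bessel_entire_def P_def[symmetric] by (rule the_equality)
  then show ?A "x \<noteq> 0 \<Longrightarrow> ?B" ?C
    using hol val by (auto simp: h_def)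
qed

end

theory Submission
  imports Defs
begin

text \<open>Expand the Wronskian along the row of \<open>L\<^sub>s\<close>. The \<open>l\<close>-th derivative of \<open>L\<^sub>s\<close> with parameter \<open>\<alpha>\<close> is
  \<open>(-1)\<^sup>l L\<^bsub>s-l\<^esub>\<close> with parameter \<open>\<alpha> + l\<close>, so by the Mehler--Heine asymptotics it is of order
  \<open>n powr (\<alpha> + l)\<close> at \<open>x / (4 * n)\<close>, while its cofactor tends to the value of that cofactor at \<open>0\<close>. After division by
  \<open>n powr (\<alpha> + r)\<close> only the term with \<open>l = r\<close> survives, and its cofactor is the Wronskian of the seed
  functions. The Mehler--Heine limit itself is Tannery's theorem applied to the coefficients; it
  holds for every real parameter, and for degrees \<open>m n\<close> with \<open>m n / n\<close> tending to \<open>1\<close>, so the fixed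
  offset between \<open>s\<close> and \<open>n\<close> is harmless.\<close>

section \<open>Binomial ratios, degrees asymptotic to \<open>n\<close>, and uniform limits\<close>

text \<open>By the two absorption identities, both sides equal
  \<open>a * ((a - 1) gchoose p)\<close>. This controls the quotient of neighbouring Laguerre
  coefficients.\<close>

lemma gbinomial_Suc_ratio:
  fixes a :: "'a::field_char_0"
  shows "of_nat (Suc p) * (a gchoose Suc p) = (a - of_nat p) * (a gchoose p)"
  using gbinomial_absorption[of p a] gbinomial_absorb_comp[of a p] by simp

lemma filterlim_at_top_of_ratio:
  fixes m :: "nat \<Rightarrow> nat"
  assumes m: "(\<lambda>n. real (m n) / real n) \<longlonglongrightarrow> 1"
  shows "filterlim m at_top sequentially"
  unfolding filterlim_at_top
proof
  fix k
  have "filterlim (\<lambda>n. real (m n) / real n * real n) at_top sequentially"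
    by (rule filterlim_tendsto_pos_mult_at_top[OF m _ filterlim_real_sequentially]) simp
  then have "eventually (\<lambda>n. real (m n) / real n * real n \<ge> real k) sequentially"
    by (simp add: filterlim_at_top)
  with eventually_gt_at_top[of 0] show "eventually (\<lambda>n. m n \<ge> k) sequentially"
    by eventually_elim simp
qed

lemma ratio_diff_tendsto:
  fixes m :: "nat \<Rightarrow> nat"
  assumes m: "(\<lambda>n. real (m n) / real n) \<longlonglongrightarrow> 1"
  shows "(\<lambda>n. real (m n - k) / real n) \<longlonglongrightarrow> 1"
proof -
  have "(\<lambda>n. real (m n) / real n - real k / real n) \<longlonglongrightarrow> 1 - 0"
    by (intro tendsto_diff m tendsto_divide_0[OF tendsto_const] filterlim_at_top_imp_at_infinity
        filterlim_real_sequentially)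
  moreover have "eventually (\<lambda>n. m n \<ge> k) sequentially"
    using filterlim_at_top_of_ratio[OF m] by (simp add: filterlim_at_top)
  then have "eventually (\<lambda>n. real (m n) / real n - real k / real n = real (m n - k) / real n) sequentially"
    by eventually_elim (simp add: of_nat_diff diff_divide_distrib)
  ultimately show ?thesis
    using tendsto_cong by force
qed

lemma uniform_limit_of_tendsto:
  "(f \<longlongrightarrow> l) F \<Longrightarrow> uniform_limit S (\<lambda>n x. f n) (\<lambda>x. l) F"
  by (rule uniform_limitI) (auto dest: tendstoD elim: eventually_mono)

lemma uniform_limit_sum:
  fixes f :: "'i \<Rightarrow> 'a \<Rightarrow> 'b \<Rightarrow> 'c::real_normed_vector"
  assumes "\<And>i. i \<in> I \<Longrightarrow> uniform_limit S (f i) (l i) F"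
  shows "uniform_limit S (\<lambda>n x. \<Sum>i\<in>I. f i n x) (\<lambda>x. \<Sum>i\<in>I. l i x) F"
  using assms
  by (induction I rule: infinite_finite_induct) (auto intro!: uniform_limit_add uniform_limit_const)

section \<open>Asymptotics of a single Laguerre coefficient\<close>

text \<open>Upper negation makes the upper entry constant in \<open>n\<close>, so that
  \<open>gbinomial_asymptotic\<close> applies along the degrees \<open>m n - k\<close>. Since
  \<open>rGamma\<close> vanishes at the poles of Gamma, every real \<beta> is covered.\<close>

lemma gbinomial_shift_asymptotic:
  fixes \<beta> :: real and m :: "nat \<Rightarrow> nat"
  assumes m: "(\<lambda>n. real (m n) / real n) \<longlonglongrightarrow> 1"
  shows "(\<lambda>n. ((real (m n) + \<beta>) gchoose (m n - k)) / real n powr (\<beta> + real k))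
           \<longlonglongrightarrow> rGamma (\<beta> + real k + 1)"
proof -
  define p where "p = (\<lambda>n. m n - k)"
  \<comment> \<open>The value of \<open>p n - (m n + \<beta>) - 1\<close>, the upper entry after
    negation; it does not depend on \<open>n\<close> once \<open>m n\<close> is at least
    \<open>k\<close>.\<close>
  define z where "z = - \<beta> - real k - 1"
  have p1: "(\<lambda>n. real (p n) / real n) \<longlonglongrightarrow> 1"
    unfolding p_def by (rule ratio_diff_tendsto[OF m])
  then have p_top: "filterlim p at_top sequentially"
    by (rule filterlim_at_top_of_ratio)
  have m_ge: "eventually (\<lambda>n. m n \<ge> Suc k) sequentially"
    using filterlim_at_top_of_ratio[OF m] by (simp add: filterlim_at_top)
  have "(\<lambda>q. (z gchoose q) / ((-1) ^ q / exp ((z + 1) * of_real (ln (real q))))) \<longlonglongrightarrow> rGamma (- z)"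
    using gbinomial_asymptotic[of z] by (simp add: rGamma_inverse_Gamma)
  \<comment> \<open>The asymptotics come in powers of \<open>p n\<close>; the extra factor, which
    tends to 1, converts them to powers of \<open>n\<close>.\<close>
  from filterlim_compose[OF this p_top]
  have "(\<lambda>n. (z gchoose p n) / ((-1) ^ p n / exp ((z + 1) * ln (real (p n))))
          * (real (p n) / real n) powr (\<beta> + real k)) \<longlonglongrightarrow> rGamma (- z) * 1 powr (\<beta> + real k)"
    by (intro tendsto_mult tendsto_powr p1 tendsto_const) auto
  moreover have "eventually (\<lambda>n. (z gchoose p n) / ((-1) ^ p n / exp ((z + 1) * ln (real (p n))))
          * (real (p n) / real n) powr (\<beta> + real k)
        = ((real (m n) + \<beta>) gchoose (m n - k)) / real n powr (\<beta> + real k)) sequentially"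
    using m_ge eventually_gt_at_top[of 0]
  proof eventually_elim
    case (elim n)
    have "z = real (p n) - (real (m n) + \<beta>) - 1"
      using elim by (simp add: z_def p_def of_nat_diff)
    then have 1: "(real (m n) + \<beta>) gchoose (m n - k) = (-1) ^ p n * (z gchoose p n)"
      using gbinomial_negated_upper[of "real (m n) + \<beta>" "p n"] by (simp add: p_def)
    have p0: "real (p n) > 0" using elim by (simp add: p_def)
    have "z + 1 = - (\<beta> + real k)" by (simp add: z_def)
    then have 2: "exp ((z + 1) * ln (real (p n))) = inverse (real (p n) powr (\<beta> + real k))"
      using p0 by (simp only: powr_def exp_minus mult_minus_left) simp
    have "real (p n) powr (\<beta> + real k) > 0" using p0 by simp
    moreover have "real n powr (\<beta> + real k) > 0" using elim by simp
    ultimately show ?case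
      unfolding 1 2 using p0 by (simp add: powr_divide field_simps)
  qed
  ultimately show ?thesis
    by (auto simp: z_def algebra_simps intro: Lim_transform_eventually)
qed

section \<open>Tannery's theorem for power series, uniformly on bounded sets\<close>

text \<open>On a disc of radius \<open>R\<close> the difference of the two series is at most the sum
  of \<open>norm (A k n - b k) * R ^ k\<close>. This majorant is independent of \<open>x\<close>, so
  one application of the numerical Tannery theorem gives uniformity.\<close>

lemma tannery_power_series_uniform:
  fixes A :: "nat \<Rightarrow> nat \<Rightarrow> complex" and b :: "nat \<Rightarrow> complex"
  assumes lim: "\<And>k. A k \<longlonglongrightarrow> b k"
    and bound: "eventually (\<lambda>n. \<forall>k\<ge>N. norm (A k n) \<le> M k) sequentially"
    and M: "\<And>R. R > 0 \<Longrightarrow> summable (\<lambda>k. M k * R ^ k)"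
    and b: "\<And>x. summable (\<lambda>k. b k * x ^ k)"
    and K: "bounded K"
  shows "uniform_limit K (\<lambda>n x. \<Sum>k. A k n * x ^ k) (\<lambda>x. \<Sum>k. b k * x ^ k) sequentially"
proof -
  obtain R where R: "R > 0" "\<And>x. x \<in> K \<Longrightarrow> norm x \<le> R"
    using K unfolding bounded_pos by blast
  have sb: "summable (\<lambda>k. norm (b k) * R ^ k)"
  proof -
    \<comment> \<open>Absolute convergence at \<open>R\<close> follows from convergence at a point
      of strictly larger norm; \<open>R + 1\<close> serves.\<close>
    have "summable (\<lambda>k. norm (b k * of_real R ^ k))"
      by (rule powser_insidea[OF b[of "of_real (R + 1)"]]) (use R in \<open>simp only: norm_of_real\<close>)
    then show ?thesis using R by (simp add: norm_mult norm_power)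
  qed
  have ev: "eventually (\<lambda>(k, n). norm (norm (A k n - b k) * R ^ k) \<le> M k * R ^ k + norm (b k) * R ^ k)
          (at_top \<times>\<^sub>F sequentially)"
  proof -
    have "eventually (\<lambda>(k, n). k \<ge> N \<and> (\<forall>k\<ge>N. norm (A k n) \<le> M k)) (at_top \<times>\<^sub>F sequentially)"
      using eventually_prodI[OF eventually_ge_at_top[of N] bound] by (simp add: case_prod_unfold)
    then show ?thesis
    proof (rule eventually_mono, clarify)
      fix k n assume *: "k \<ge> N" "\<forall>k\<ge>N. norm (A k n) \<le> M k"
      have "norm (A k n - b k) \<le> M k + norm (b k)"
        using norm_triangle_ineq4[of "A k n" "b k"] * by force
      then have "norm (A k n - b k) * R ^ k \<le> (M k + norm (b k)) * R ^ k"
        using R by (intro mult_right_mono) auto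
      then show "norm (norm (A k n - b k) * R ^ k) \<le> M k * R ^ k + norm (b k) * R ^ k"
        using R by (simp add: abs_mult algebra_simps)
    qed
  qed
  have "(\<lambda>n. norm (A k n - b k) * R ^ k) \<longlonglongrightarrow> 0" for k
  proof -
    have "(\<lambda>n. norm (A k n - b k) * R ^ k) \<longlonglongrightarrow> norm (b k - b k) * R ^ k"
      by (intro tendsto_intros lim)
    then show ?thesis by simp
  qed
  from tannerys_theorem[OF this ev summable_add[OF M[OF R(1)] sb]]
  have T1: "eventually (\<lambda>n. summable (\<lambda>k. norm (A k n - b k) * R ^ k)) sequentially"
    and T2: "(\<lambda>n. \<Sum>k. norm (A k n - b k) * R ^ k) \<longlonglongrightarrow> 0"
    using R by (simp_all add: abs_mult)
  show ?thesis
  proof (rule uniform_limitI)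
    fix e :: real assume "e > 0"
    with T2 have "eventually (\<lambda>n. dist (\<Sum>k. norm (A k n - b k) * R ^ k) 0 < e) sequentially"
      by (rule tendstoD)
    with T1 show "eventually (\<lambda>n. \<forall>x\<in>K. dist (\<Sum>k. A k n * x ^ k) (\<Sum>k. b k * x ^ k) < e) sequentially"
    proof eventually_elim
      case (elim n)
      show ?case
      proof
        fix x assume x: "x \<in> K"
        have le: "norm ((A k n - b k) * x ^ k) \<le> norm (A k n - b k) * R ^ k" for k
          using R x by (auto simp: norm_mult norm_power intro!: mult_left_mono power_mono)
        have sn: "summable (\<lambda>k. norm ((A k n - b k) * x ^ k))"
          by (rule summable_comparison_test'[OF elim(1)]) (use le in auto)
        then have s: "summable (\<lambda>k. (A k n - b k) * x ^ k)"
          by (rule summable_norm_cancel)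
        have sA: "summable (\<lambda>k. A k n * x ^ k)"
          using summable_add[OF s b[of x]] by (simp add: algebra_simps)
        have "dist (\<Sum>k. A k n * x ^ k) (\<Sum>k. b k * x ^ k) = norm (\<Sum>k. (A k n - b k) * x ^ k)"
          by (simp add: dist_norm suminf_diff[OF sA b] left_diff_distrib)
        also have "\<dots> \<le> (\<Sum>k. norm ((A k n - b k) * x ^ k))"
          by (rule summable_norm[OF sn])
        also have "\<dots> \<le> (\<Sum>k. norm (A k n - b k) * R ^ k)"
          by (rule suminf_le[OF le sn elim(1)])
        also have "\<dots> < e" using elim(2) by (simp add: dist_real_def)
        finally show "dist (\<Sum>k. A k n * x ^ k) (\<Sum>k. b k * x ^ k) < e" .
      qed
    qed
  qed
qed

section \<open>Mehler--Heine asymptotics\<close>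

lemma laguerre_Mehler_Heine:
  fixes \<beta> :: real and m :: "nat \<Rightarrow> nat"
  assumes m: "(\<lambda>n. real (m n) / real n) \<longlonglongrightarrow> 1" and K: "bounded K"
  shows "uniform_limit K (\<lambda>n x. laguerre \<beta> (m n) (x / (4 * of_nat n)) / of_real (real n powr \<beta>))
           (\<lambda>x. of_real (2 powr \<beta>) * bessel_entire \<beta> x) sequentially"
proof -
  \<comment> \<open>The coefficient of \<open>x ^ k\<close> in the rescaled and normalised
    polynomial, extended by zero beyond its degree.\<close>
  define A :: "nat \<Rightarrow> nat \<Rightarrow> complex" where "A = (\<lambda>k n. if k \<le> m n
     then of_real (((real (m n) + \<beta>) gchoose (m n - k)) / real n powr (\<beta> + real k) * ((-1) ^ k / (fact k * 4 ^ k)))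
     else 0)"
  \<comment> \<open>From this index on, \<open>\<beta> + k\<close> is nonnegative, so the factor
    \<open>w = \<beta> + k + 1\<close> below is at least 1.\<close>
  define N where "N = nat \<lceil>\<bar>\<beta>\<bar>\<rceil>"
  have m_ge: "eventually (\<lambda>n. m n \<ge> k) sequentially" for k
    using filterlim_at_top_of_ratio[OF m] by (simp add: filterlim_at_top)
  have lim: "A k \<longlonglongrightarrow> bessel_coeff \<beta> k" for k
  proof -
    have "(\<lambda>n. complex_of_real (((real (m n) + \<beta>) gchoose (m n - k)) / real n powr (\<beta> + real k) * ((-1) ^ k / (fact k * 4 ^ k))))
        \<longlonglongrightarrow> of_real (rGamma (\<beta> + real k + 1) * ((-1) ^ k / (fact k * 4 ^ k)))"
      by (intro tendsto_of_real tendsto_mult gbinomial_shift_asymptotic m tendsto_const)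
    also have "complex_of_real (rGamma (\<beta> + real k + 1) * ((-1) ^ k / (fact k * 4 ^ k))) = bessel_coeff \<beta> k"
      by (simp add: bessel_coeff_def rGamma_complex_of_real[symmetric])
    finally show ?thesis
      by (rule tendsto_cong[THEN iffD1, rotated]) (use m_ge[of k] in \<open>auto simp: A_def elim: eventually_mono\<close>)
  qed
  have "Bseq (A N)" using lim convergent_def convergent_imp_Bseq by blast
  then obtain D where D: "\<And>n. norm (A N n) \<le> D" by (auto simp: Bseq_def)
  \<comment> \<open>The argument \<open>x / (4 * n)\<close> contributes a factor
    \<open>1 / (4 * n)\<close> per degree, so this crude bound on \<open>m n\<close> is all that the
    ratio estimate requires.\<close>
  have ev: "eventually (\<lambda>n. real (m n) \<le> 4 * real n \<and> n > 0) sequentially"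
  proof -
    have "eventually (\<lambda>n. real (m n) / real n < 4) sequentially"
      by (rule order_tendstoD(2)[OF m]) simp
    with eventually_gt_at_top[of 0] show ?thesis by eventually_elim (auto simp: field_simps)
  qed
  \<comment> \<open>Passing from \<open>k\<close> to \<open>k + 1\<close> multiplies the absolute
    value by \<open>(m n - k) / (4 * n * (k + 1) * w)\<close>. Here \<open>m n - k\<close> is at
    most \<open>4 * n\<close> and \<open>w\<close> is at least 1, which leaves at most
    \<open>1 / (k + 1)\<close>.\<close>
  have ratio: "norm (A (Suc k) n) * real (Suc k) \<le> norm (A k n)"
    if k: "k \<ge> N" and n: "real (m n) \<le> 4 * real n" "n > 0" for k n
  proof (cases "Suc k \<le> m n")
    case True
    define p where "p = m n - Suc k"
    have p: "m n - k = Suc p" "real p = real (m n) - real k - 1" "m n - Suc k = p"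
      using True by (auto simp: p_def)
    define g where "g = ((real (m n) + \<beta>) gchoose p)"
    define h where "h = ((real (m n) + \<beta>) gchoose Suc p)"
    define w where "w = \<beta> + real k + 1"
    have w: "w \<ge> 1" using k by (simp add: w_def N_def nat_le_iff ceiling_le_iff) 
    have "real (Suc p) * h = w * g"
      using gbinomial_Suc_ratio[of p "real (m n) + \<beta>"] by (simp add: p w_def g_def h_def)
    then have "\<bar>real (Suc p) * h\<bar> = \<bar>w * g\<bar>"
      by simp
    then have G: "\<bar>h\<bar> = w * \<bar>g\<bar> / real (Suc p)"
      using w by (simp add: abs_mult eq_divide_eq mult.commute del: of_nat_Suc)
    define t where "t = real n powr (\<beta> + real k)"
    have t: "t > 0" using n by (simp add: t_def)
    have t': "real n powr (\<beta> + real (Suc k)) = t * real n"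
      using n powr_add[of "real n" "\<beta> + real k" 1] by (simp add: t_def algebra_simps)
    have "norm (A (Suc k) n) * real (Suc k) = \<bar>g\<bar> / (t * real n) * (1 / (fact k * 4 ^ Suc k))"
      using True n t unfolding A_def t' p g_def[symmetric]
      by (simp add: norm_mult norm_divide norm_power abs_mult field_simps del: of_nat_Suc)
    also have "\<dots> = \<bar>g\<bar> / t * (1 / (fact k * 4 ^ k)) * (1 / (4 * real n))"
      by simp
    also have "\<dots> \<le> \<bar>g\<bar> / t * (1 / (fact k * 4 ^ k)) * (w / real (Suc p))"
    proof (intro mult_left_mono)
      have "real (Suc p) \<le> 4 * real n" using p n by simp
      then have "1 / (4 * real n) \<le> 1 / real (Suc p)" using n by (intro divide_left_mono) auto
      also have "\<dots> \<le> w / real (Suc p)" using w by (intro divide_right_mono) auto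
      finally show "1 / (4 * real n) \<le> w / real (Suc p)" .
    qed (use t in auto)
    also have "\<dots> = norm (A k n)"
      using True t unfolding A_def p h_def[symmetric] t_def[symmetric]
      by (simp add: norm_mult norm_divide norm_power abs_mult G field_simps del: of_nat_Suc)
    finally show ?thesis .
  qed (simp add: A_def)
  \<comment> \<open>Iterating the ratio from \<open>N\<close> gives factorial decay with constants
    independent of \<open>n\<close>, because the convergent sequence \<open>A N\<close> is bounded
    by \<open>D\<close>.\<close>
  have bound: "eventually (\<lambda>n. \<forall>k\<ge>N. norm (A k n) \<le> D * fact N * (1 / fact k)) sequentially"
    using ev
  proof eventually_elim
    case (elim n)
    have "norm (A k n) * fact k \<le> D * fact N" if "k \<ge> N" for k
      using that
    proof (induction k rule: dec_induct)
      case base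
      show ?case using D[of n] by simp
    next
      case (step k)
      have "norm (A (Suc k) n) * fact (Suc k) = norm (A (Suc k) n) * real (Suc k) * fact k"
        by (simp add: algebra_simps)
      also have "\<dots> \<le> norm (A k n) * fact k"
        using ratio[of k n] step elim by (intro mult_right_mono) auto
      also have "\<dots> \<le> D * fact N"
        using step by simp
      finally show ?case .
    qed
    then show ?case by (simp add: field_simps)
  qed
  have "summable (\<lambda>k. D * fact N * (1 / fact k) * R ^ k)" for R :: real
    using summable_mult[OF summable_exp[of R], of "D * fact N"] by (simp add: field_simps)
  from tannery_power_series_uniform[OF lim bound this summable_bessel K]
  have "uniform_limit K (\<lambda>n x. \<Sum>k. A k n * x ^ k) (\<lambda>x. \<Sum>k. bessel_coeff \<beta> k * x ^ k) sequentially"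
    by simp
  moreover have "eventually (\<lambda>n. \<forall>x\<in>K. (\<Sum>k. A k n * x ^ k) =
      laguerre \<beta> (m n) (x / (4 * of_nat n)) / of_real (real n powr \<beta>)) sequentially"
    using eventually_gt_at_top[of 0]
  proof eventually_elim
    case (elim n)
    show ?case
    proof
      fix x
      have "(\<Sum>k. A k n * x ^ k) = (\<Sum>k\<le>m n. A k n * x ^ k)"
        by (rule suminf_finite) (auto simp: A_def)
      also have "\<dots> = laguerre \<beta> (m n) (x / (4 * of_nat n)) / of_real (real n powr \<beta>)"
        unfolding laguerre_def sum_divide_distrib
      proof (intro sum.cong refl)
        fix k assume k: "k \<in> {..m n}"
        have "real n powr (\<beta> + real k) = real n powr \<beta> * real n ^ k"
          using elim by (simp add: powr_add powr_realpow)
        moreover have "(- (x / (4 * of_nat n))) ^ k = (-1) ^ k * x ^ k / (4 ^ k * of_nat n ^ k)"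
          unfolding power_minus[of "x / (4 * of_nat n)"] by (simp add: power_divide power_mult_distrib)
        ultimately show "A k n * x ^ k = of_real ((real (m n) + \<beta>) gchoose (m n - k)) *
            (- (x / (4 * of_nat n))) ^ k / fact k / of_real (real n powr \<beta>)"
          using k elim
          by (simp add: A_def field_simps)
      qed
      finally show "(\<Sum>k. A k n * x ^ k) = \<dots>" .
    qed
  qed
  \<comment> \<open>The factor \<open>2 powr \<beta>\<close> cancels the
    \<open>2 powr (- \<beta>)\<close> contained in \<open>bessel_entire\<close>.\<close>
  moreover have "of_real (2 powr \<beta>) * bessel_entire \<beta> x = (\<Sum>k. bessel_coeff \<beta> k * x ^ k)" for x
  proof -
    have "complex_of_real (2 powr \<beta>) * of_real (2 powr (- \<beta>)) = 1"
      by (simp flip: of_real_mult powr_add)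
    then show ?thesis
      unfolding bessel_entire_characterization(3) mult.assoc[symmetric] by simp
  qed
  ultimately show ?thesis
    by (auto elim!: uniform_limit_cong[THEN iffD1, rotated -1])
qed

section \<open>Derivatives of Laguerre polynomials and their limits\<close>

text \<open>After the constant term is split off and the index shifted, lowering the degree and
  raising \<alpha> by one leave each binomial coefficient unchanged, since
  \<open>Suc n + \<alpha> = n + (\<alpha> + 1)\<close>.\<close>

lemma has_field_derivative_laguerre:
  "(laguerre \<alpha> (Suc n) has_field_derivative - laguerre (\<alpha> + 1) n x) (at x)"
proof -
  let ?c = "\<lambda>k. complex_of_real ((real n + (\<alpha> + 1)) gchoose (n - k))"
  have "laguerre \<alpha> (Suc n) = (\<lambda>x. of_real ((real (Suc n) + \<alpha>) gchoose Suc n) +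
      (\<Sum>k\<le>n. ?c k * (- x) ^ Suc k / fact (Suc k)))"
    unfolding laguerre_def sum.atMost_Suc_shift by (simp add: add_ac)
  moreover have "((\<lambda>x. of_real ((real (Suc n) + \<alpha>) gchoose Suc n) +
      (\<Sum>k\<le>n. ?c k * (- x) ^ Suc k / fact (Suc k))) has_field_derivative
      0 + (\<Sum>k\<le>n. - (?c k * (- x) ^ k / fact k))) (at x)"
  proof (intro DERIV_add DERIV_const DERIV_sum)
    fix k
    have "((\<lambda>x. ?c k * (- x) ^ Suc k / fact (Suc k)) has_field_derivative
        ?c k * (of_nat (Suc k) * (- x) ^ k * (- 1)) / fact (Suc k)) (at x)"
      by (rule derivative_eq_intros refl | simp del: of_nat_Suc fact_Suc)+
    also have "?c k * (of_nat (Suc k) * (- x) ^ k * (- 1)) / fact (Suc k) = - (?c k * (- x) ^ k / fact k)"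
      by (simp del: of_nat_Suc)
    finally show "((\<lambda>x. ?c k * (- x) ^ Suc k / fact (Suc k)) has_field_derivative
        - (?c k * (- x) ^ k / fact k)) (at x)" .
  qed
  ultimately show ?thesis
    by (simp add: laguerre_def sum_negf)
qed

text \<open>The bound on \<open>j\<close> keeps \<open>n - j\<close> from truncating: for larger
  \<open>j\<close> the derivative is zero, while \<open>laguerre\<close> of degree 0 is 1.\<close>

lemma higher_deriv_laguerre:
  assumes "j \<le> n"
  shows "(deriv ^^ j) (laguerre \<alpha> n) = (\<lambda>x. (-1) ^ j * laguerre (\<alpha> + real j) (n - j) x)"
  using assms
proof (induction j)
  case (Suc j)
  then obtain l where l: "n - j = Suc l" "n - Suc j = l"
    by (metis Suc_diff_Suc Suc_le_lessD)
  have "((\<lambda>x. (-1) ^ j * laguerre (\<alpha> + real j) (Suc l) x) has_field_derivative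
      (-1) ^ j * (- laguerre (\<alpha> + real j + 1) l x)) (at x)" for x
    by (intro DERIV_cmult has_field_derivative_laguerre)
  then have "deriv (\<lambda>x. (-1) ^ j * laguerre (\<alpha> + real j) (Suc l) x) =
      (\<lambda>x. (-1) ^ j * (- laguerre (\<alpha> + real j + 1) l x))"
    by (intro ext DERIV_imp_deriv)
  then show ?case
    using Suc l by (simp add: add_ac)
qed simp

lemma higher_deriv_laguerre_limit:
  assumes m: "(\<lambda>n. real (m n) / real n) \<longlonglongrightarrow> 1" and K: "bounded K"
  shows "uniform_limit K
     (\<lambda>n x. (deriv ^^ j) (laguerre \<alpha> (m n)) (x / (4 * of_nat n)) / of_real (real n powr (\<alpha> + real j)))
     (\<lambda>x. (-1) ^ j * (of_real (2 powr (\<alpha> + real j)) * bessel_entire (\<alpha> + real j) x)) sequentially"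
proof -
  have ge: "eventually (\<lambda>n. m n \<ge> j) sequentially"
    using filterlim_at_top_of_ratio[OF m] by (simp add: filterlim_at_top)
  have "uniform_limit K
      (\<lambda>n x. (-1) ^ j * (laguerre (\<alpha> + real j) (m n - j) (x / (4 * of_nat n)) / of_real (real n powr (\<alpha> + real j))))
      (\<lambda>x. (-1) ^ j * (of_real (2 powr (\<alpha> + real j)) * bessel_entire (\<alpha> + real j) x)) sequentially"
    by (intro bounded_linear.uniform_limit[OF bounded_linear_mult_right] laguerre_Mehler_Heine
        ratio_diff_tendsto m K)
  then show ?thesis
    by (rule uniform_limit_cong[THEN iffD1, rotated -1])
       (use ge in \<open>auto simp: higher_deriv_laguerre elim!: eventually_mono\<close>)
qed

section \<open>Expansion of the Wronskian in its last function\<close>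

text \<open>The minor that accompanies the \<open>l\<close>-th derivative of an appended function:
  the derivative orders run from 0 to \<open>length fs\<close> with \<open>l\<close> left
  out.\<close>

definition wronskian_omit :: "(complex \<Rightarrow> complex) list \<Rightarrow> nat \<Rightarrow> complex \<Rightarrow> complex" where
  "wronskian_omit fs l x = Determinant.det (Matrix.mat (length fs) (length fs)
     (\<lambda>(i, j). (deriv ^^ (if j < l then j else Suc j)) (fs ! i) x))"

lemma wronskian_omit_length: "wronskian_omit fs (length fs) = wronskian fs"
  unfolding wronskian_omit_def wronskian_def
  by (intro ext arg_cong[of _ _ Determinant.det] eq_matI) auto

text \<open>Laplace expansion along the last row. It isolates the appended function, which is the
  only one that varies with \<open>n\<close>, from minors built from \<open>fs\<close>
  alone.\<close>

lemma wronskian_append_single: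
  "wronskian (fs @ [g]) x =
     (\<Sum>l\<le>length fs. (deriv ^^ l) g x * ((-1) ^ (length fs + l) * wronskian_omit fs l x))"
proof -
  define M where "M = Matrix.mat (Suc (length fs)) (Suc (length fs))
     (\<lambda>(i, j). (deriv ^^ j) ((fs @ [g]) ! i) x)"
  have "wronskian (fs @ [g]) x = Determinant.det M"
    by (simp add: wronskian_def M_def)
  also have "\<dots> = (\<Sum>l<Suc (length fs). M $$ (length fs, l) * cofactor M (length fs) l)"
    by (rule laplace_expansion_row) (auto simp: M_def)
  also have "\<dots> = (\<Sum>l\<le>length fs. (deriv ^^ l) g x * ((-1) ^ (length fs + l) * wronskian_omit fs l x))"
    unfolding lessThan_Suc_atMost
  proof (intro sum.cong refl)
    fix l assume "l \<in> {..length fs}"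
    moreover have "mat_delete M (length fs) l = Matrix.mat (length fs) (length fs)
       (\<lambda>(i, j). (deriv ^^ (if j < l then j else Suc j)) (fs ! i) x)"
      by (rule eq_matI) (auto simp: mat_delete_def M_def nth_append)
    ultimately show "M $$ (length fs, l) * cofactor M (length fs) l =
        (deriv ^^ l) g x * ((-1) ^ (length fs + l) * wronskian_omit fs l x)"
      by (simp add: cofactor_def wronskian_omit_def M_def nth_append)
  qed
  finally show ?thesis .
qed

text \<open>The Leibniz formula writes the minor as a finite sum of products of derivatives, each of
  which is holomorphic.\<close>

lemma isCont_wronskian_omit:
  assumes "\<And>f. f \<in> set fs \<Longrightarrow> f holomorphic_on UNIV"
  shows "isCont (wronskian_omit fs l) z"
proof -
  let ?r = "length fs"
  have eq: "wronskian_omit fs l = (\<lambda>x. \<Sum>p | p permutes {0..<?r}. signof p *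
      (\<Prod>i = 0..<?r. (deriv ^^ (if p i < l then p i else Suc (p i))) (fs ! i) x))"
  proof
    fix x
    show "wronskian_omit fs l x = (\<Sum>p | p permutes {0..<?r}. signof p *
      (\<Prod>i = 0..<?r. (deriv ^^ (if p i < l then p i else Suc (p i))) (fs ! i) x))"
      unfolding wronskian_omit_def
      by (subst det_def'[where n = ?r])
         (auto intro!: sum.cong prod.cong arg_cong2[of _ _ _ _ "(*)"] simp: permutes_in_image)
  qed
  have "isCont ((deriv ^^ k) (fs ! i)) z" if "i < ?r" for k i
  proof -
    have "(deriv ^^ k) (fs ! i) holomorphic_on UNIV"
      using that by (intro holomorphic_higher_deriv assms) auto
    then show ?thesis
      using holomorphic_on_imp_continuous_on continuous_on_eq_continuous_at open_UNIV by blast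
  qed
  then show ?thesis
    unfolding eq by (intro continuous_intros) auto
qed

section \<open>Holomorphic seed functions and limits at the rescaled argument\<close>

lemma holomorphic_laguerre: "f holomorphic_on S \<Longrightarrow> (\<lambda>x. laguerre \<alpha> n (f x)) holomorphic_on S"
  unfolding laguerre_def by (intro holomorphic_intros) auto

lemma seed_functions_holomorphic: "f \<in> set (seed_functions \<alpha> lam mu) \<Longrightarrow> f holomorphic_on UNIV"
  unfolding seed_functions_def
  by (auto intro!: holomorphic_intros holomorphic_laguerre holomorphic_laguerre[of "\<lambda>x. x", simplified])

text \<open>The points \<open>x / (4 * n)\<close> shrink to 0 at a rate governed by the radius of
  \<open>K\<close> alone, so continuity at 0 suffices.\<close>

lemma uniform_limit_rescaled_argument:
  fixes g :: "complex \<Rightarrow> complex"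
  assumes g: "isCont g 0" and K: "bounded K"
  shows "uniform_limit K (\<lambda>n x. g (x / (4 * of_nat n))) (\<lambda>_. g 0) sequentially"
proof (rule uniform_limitI)
  fix e :: real assume "e > 0"
  with g obtain d where d: "d > 0" "\<And>y. dist y 0 < d \<Longrightarrow> dist (g y) (g 0) < e"
    unfolding continuous_at_eps_delta by blast
  obtain R where R: "R > 0" "\<And>x. x \<in> K \<Longrightarrow> norm x \<le> R"
    using K unfolding bounded_pos by blast
  obtain N :: nat where N: "real N > R / d" using reals_Archimedean2 by blast
  have "eventually (\<lambda>n. n \<ge> N \<and> n > 0) sequentially"
    by (intro eventually_conj eventually_ge_at_top eventually_gt_at_top)
  then show "eventually (\<lambda>n. \<forall>x\<in>K. dist (g (x / (4 * of_nat n))) (g 0) < e) sequentially"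
  proof eventually_elim
    case (elim n)
    show ?case
    proof
      fix x assume x: "x \<in> K"
      have "R < real N * d" using N d by (simp add: field_simps)
      also have "\<dots> \<le> real n * d" using elim d by (intro mult_right_mono) auto
      finally have "norm x < real n * d" using R(2)[OF x] by simp
      also have "\<dots> \<le> d * (4 * real n)" using d by simp
      finally show "dist (g (x / (4 * of_nat n))) (g 0) < e"
        using elim by (intro d) (simp add: norm_divide norm_mult field_simps)
    qed
  qed
qed

section \<open>The limit of the exceptional polynomials\<close>

theorem theorem6p3:
  fixes \<alpha> :: real and lam mu :: "nat list" and r :: nat and K :: "complex set"
  assumes "is_partition lam" and "is_partition mu"
    and "r = length lam + length mu"
    and "compact K"
  shows "uniform_limit K
    (\<lambda>n x. of_real ((-1) ^ r / real n powr (\<alpha> + real r)) *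
       exceptional_laguerre \<alpha> lam mu n (x / (4 * of_nat n)))
    (\<lambda>x. generalized_laguerre \<alpha> lam mu 0 * of_real (2 powr (\<alpha> + real r)) *
       bessel_entire (\<alpha> + real r) x)
    (inf sequentially (principal (degree_sequence lam mu)))"
proof -
  let ?fs = "seed_functions \<alpha> lam mu"
  define s where "s = (\<lambda>n. n + length lam - sum_list lam - sum_list mu)"
  \<comment> \<open>Each summand of the expansion is split as \<open>D * (T * E)\<close>: the
    derivative normalised at its own order, with limit \<open>B\<close>; the leftover power
    \<open>n powr (l - r)\<close>; and the cofactor with the exponential and the global
    sign.\<close>
  define D where "D = (\<lambda>l n x. (deriv ^^ l) (laguerre \<alpha> (s n)) (x / (4 * of_nat n)) / of_real (real n powr (\<alpha> + real l)))"
  define E where "E = (\<lambda>l x. (-1) ^ r * exp (- of_nat (length mu) * x) * ((-1) ^ (r + l) * wronskian_omit ?fs l x))"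
  define B where "B = (\<lambda>l x. (-1) ^ l * (complex_of_real (2 powr (\<alpha> + real l)) * bessel_entire (\<alpha> + real l) x))"
  define T where "T = (\<lambda>l n. complex_of_real (real n powr (real l - real r)))"
  have len: "length ?fs = r"
    using assms(3) by (simp add: seed_functions_def shifted_parts_def del: upt_Suc)
  have K: "bounded K" using assms(4) compact_imp_bounded by blast
  have s: "(\<lambda>n. real (s n) / real n) \<longlonglongrightarrow> 1"
  proof -
    \<comment> \<open>For large \<open>n\<close> no subtraction in \<open>s n\<close> truncates, so
      \<open>s n\<close> is \<open>n\<close> plus this constant.\<close>
    define c where "c = real (length lam) - real (sum_list lam) - real (sum_list mu)"
    have "(\<lambda>n. 1 + c / real n) \<longlonglongrightarrow> 1 + 0"
      by (intro tendsto_add tendsto_const tendsto_divide_0[OF tendsto_const] filterlim_at_top_imp_at_infinity filterlim_real_sequentially)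
    moreover have "eventually (\<lambda>n. 1 + c / real n = real (s n) / real n) sequentially"
      using eventually_ge_at_top[of "sum_list lam + sum_list mu + 1"]
    proof eventually_elim
      case (elim n)
      then have "real (s n) = real n + c" by (simp add: s_def c_def of_nat_diff)
      then show ?case using elim by (simp add: add_divide_distrib)
    qed
    ultimately show ?thesis using tendsto_cong by force
  qed
  \<comment> \<open>Products of uniform limits converge uniformly only when the limits are bounded;
    here compactness of \<open>K\<close> provides this.\<close>
  have bB: "bounded (B l ` K)" for l
  proof -
    have "bessel_entire (\<alpha> + real l) holomorphic_on UNIV"
      by (rule bessel_entire_characterization)
    then have "continuous_on K (bessel_entire (\<alpha> + real l))"
      by (meson continuous_on_subset holomorphic_on_imp_continuous_on subset_UNIV)
    then have "continuous_on K (B l)"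
      unfolding B_def by (intro continuous_intros)
    then show ?thesis
      using assms(4) compact_continuous_image compact_imp_bounded by blast
  qed
  have limT: "(\<lambda>n. T l n) \<longlonglongrightarrow> (if l = r then 1 else 0)" if "l \<le> r" for l
  proof (cases "l = r")
    case True
    have "eventually (\<lambda>n. T l n = 1) sequentially"
      using eventually_gt_at_top[of 0] by eventually_elim (simp add: T_def True)
    then show ?thesis using True by (simp add: tendsto_eventually)
  next
    case False
    have "(\<lambda>n. real n powr (real l - real r)) \<longlonglongrightarrow> 0"
      by (rule tendsto_neg_powr[OF _ filterlim_real_sequentially]) (use that False in auto)
    then have "(\<lambda>n. T l n) \<longlonglongrightarrow> of_real 0"
      unfolding T_def by (rule tendsto_of_real)
    then show ?thesis using False by simp
  qed
  have limE: "uniform_limit K (\<lambda>n x. E l (x / (4 * of_nat n))) (\<lambda>_. E l 0) sequentially" for l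
  proof (rule uniform_limit_rescaled_argument[OF _ K])
    show "isCont (E l) 0"
      unfolding E_def by (intro continuous_intros isCont_wronskian_omit seed_functions_holomorphic)
  qed
  have "uniform_limit K (\<lambda>n x. \<Sum>l\<le>r. D l n x * (T l n * E l (x / (4 * of_nat n))))
      (\<lambda>x. \<Sum>l\<le>r. B l x * ((if l = r then 1 else 0) * E l 0)) sequentially"
  proof (intro uniform_limit_sum uniform_lim_mult bB limE)
    fix l assume "l \<in> {..r}"
    then show "uniform_limit K (\<lambda>n x. T l n) (\<lambda>x. if l = r then 1 else 0) sequentially"
      by (intro uniform_limit_of_tendsto limT) auto
    show "uniform_limit K (D l) (B l) sequentially"
      unfolding D_def B_def by (rule higher_deriv_laguerre_limit[OF s K])
  qed (auto simp: image_constant_conv)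
  moreover have "(\<Sum>l\<le>r. D l n x * (T l n * E l (x / (4 * of_nat n)))) =
      of_real ((-1) ^ r / real n powr (\<alpha> + real r)) * exceptional_laguerre \<alpha> lam mu n (x / (4 * of_nat n))"
    for n x
  \<comment> \<open>At \<open>n = 0\<close> both sides are zero, since \<open>0 powr a = 0\<close>
    and division by zero gives zero.\<close>
  proof (cases "n = 0")
    case False
    let ?y = "x / (4 * of_nat n)"
    have DT: "D l n x * T l n = (deriv ^^ l) (laguerre \<alpha> (s n)) ?y / of_real (real n powr (\<alpha> + real r))" for l
    proof -
      have "real n powr (\<alpha> + real r) * real n powr (real l - real r) = real n powr (\<alpha> + real l)"
        by (simp flip: powr_add)
      then have "complex_of_real (real n powr (\<alpha> + real l)) = of_real (real n powr (\<alpha> + real r)) * T l n"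
        unfolding T_def by (metis of_real_mult)
      moreover have "T l n \<noteq> 0" using False by (simp add: T_def)
      ultimately show ?thesis by (simp add: D_def)
    qed
    have "exceptional_laguerre \<alpha> lam mu n ?y = exp (- of_nat (length mu) * ?y) *
        (\<Sum>l\<le>r. (deriv ^^ l) (laguerre \<alpha> (s n)) ?y * ((-1) ^ (r + l) * wronskian_omit ?fs l ?y))"
      unfolding exceptional_laguerre_def wronskian_append_single len s_def ..
    then show ?thesis
      unfolding mult.assoc[symmetric] DT
      by (simp add: E_def sum_distrib_left mult_ac)
  qed (simp add: D_def)
  moreover have "(\<Sum>l\<le>r. B l x * ((if l = r then 1 else 0) * E l 0)) =
      generalized_laguerre \<alpha> lam mu 0 * of_real (2 powr (\<alpha> + real r)) * bessel_entire (\<alpha> + real r) x" for x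
  proof -
    have "(\<Sum>l\<le>r. B l x * ((if l = r then 1 else 0) * E l 0)) = (\<Sum>l\<le>r. if l = r then B r x * E r 0 else 0)"
      by (intro sum.cong) auto
    also have "\<dots> = B r x * E r 0" by simp
    \<comment> \<open>The cofactor sign \<open>(-1) ^ (r + r)\<close> is 1 and the minor is the full
      Wronskian. The remaining \<open>(-1) ^ r\<close> cancels the sign in
      \<open>B r\<close>.\<close>
    also have "E r 0 = (-1) ^ r * generalized_laguerre \<alpha> lam mu 0"
      using wronskian_omit_length[of ?fs] by (simp add: E_def len generalized_laguerre_def flip: mult_2)
    finally show ?thesis
      by (simp add: B_def mult_ac flip: power_mult_distrib)
  qed
  ultimately have "uniform_limit K
    (\<lambda>n x. of_real ((-1) ^ r / real n powr (\<alpha> + real r)) *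
       exceptional_laguerre \<alpha> lam mu n (x / (4 * of_nat n)))
    (\<lambda>x. generalized_laguerre \<alpha> lam mu 0 * of_real (2 powr (\<alpha> + real r)) *
       bessel_entire (\<alpha> + real r) x) sequentially"
    by simp
  \<comment> \<open>The limit along all naturals passes to the smaller filter of the degree
    sequence.\<close>
  then show ?thesis
    by (rule filterlim_mono) auto
qed

end
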